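(* Suppose that $E$ and $F$ are two ordered Banach spaces, $C$ is an open convex subset of $E$, $\mathbf{x}\ge\mathbf{y}\ge\mathbf{z}$ is a triplet of points in $C$, $\omega:[0,\infty)\to F$, and $\Phi:C\to F$ is a Gâteaux differentiable $\omega$-convex function whose differential is isotone. (a) If $\mathbf{x}\ge(\mathbf{x}+\mathbf{y}+\mathbf{z})/3\ge\mathbf{y}\ge\mathbf{z}$, then $$\frac{\Phi(\mathbf{x})+\Phi(\mathbf{y})+\Phi(\mathbf{z})}{3}+\Phi\left(\frac{\mathbf{x}+\mathbf{y}+\mathbf{z}}{3}\right)\ge\frac{2}{3}\left[\Phi\left(\frac{\mathbf{x}+\mathbf{y}}{2}\right)+\Phi\left(\frac{\mathbf{y}+\mathbf{z}}{2}\right)+\Phi\left(\frac{\mathbf{z}+\mathbf{x}}{2}\right)\right]$$ $$+\frac{1}{6}\omega\left(\frac{\|\mathbf{x}-\mathbf{y}\|}{2}\right)+\frac{1}{6}\omega\left(\frac{\|2\mathbf{z}-\mathbf{x}-\mathbf{y}\|}{6}\right)+\frac{1}{3}\omega\left(\frac{\|2\mathbf{y}-\mathbf{x}-\mathbf{z}\|}{6}\right)+\frac{1}{3}\omega\left(\frac{\|\mathbf{z}-\mathbf{y}\|}{2}\right).$$ (b) If $\mathbf{x}\ge\mathbf{y}\ge(\mathbf{x}+\mathbf{y}+\mathbf{z})/3\ge\mathbf{z}$, then $$\frac{\Phi(\mathbf{x})+\Phi(\mathbf{y})+\Phi(\mathbf{z})}{3}+\Phi\left(\frac{\mathbf{x}+\mathbf{y}+\mathbf{z}}{3}\right)\ge\frac{2}{3}\left[\Phi\left(\frac{\mathbf{x}+\mathbf{y}}{2}\right)+\Phi\left(\frac{\mathbf{y}+\mathbf{z}}{2}\right)+\Phi\left(\frac{\mathbf{z}+\mathbf{x}}{2}\right)\right]$$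 $$+\frac{1}{3}\omega\left(\frac{\|\mathbf{x}-\mathbf{y}\|}{2}\right)+\frac{1}{6}\omega\left(\frac{\|2\mathbf{x}-\mathbf{y}-\mathbf{z}\|}{6}\right)+\frac{1}{3}\omega\left(\frac{\|2\mathbf{y}-\mathbf{x}-\mathbf{z}\|}{6}\right)+\frac{1}{6}\omega\left(\frac{\|\mathbf{z}-\mathbf{y}\|}{2}\right).$$
   Context: An ordered Banach space is a real Banach space $E$ with the partial order $\mathbf{x}\le\mathbf{y}\iff\mathbf{y}-\mathbf{x}\in E_+$ given by a closed proper convex cone $E_+$. $\Phi:C\to F$ is $\omega$-convex if $\Phi((1-\lambda)\mathbf{u}+\lambda\mathbf{v})\le(1-\lambda)\Phi(\mathbf{u})+\lambda\Phi(\mathbf{v})-\lambda(1-\lambda)\,\omega(\|\mathbf{u}-\mathbf{v}\|)$ for all $\mathbf{u},\mathbf{v}\in C$ and $\lambda\in(0,1)$; $\omega$ is not assumed to be nonnegative. For Gâteaux differentiable $\Phi$, $\Phi'(\mathbf{a}):E\to F$ is a bounded linear operator, and the differential is isotone if $\mathbf{a}\le\mathbf{b}$ in $C$ implies $\Phi'(\mathbf{a})\mathbf{v}\le\Phi'(\mathbf{b})\mathbf{v}$ for all $\mathbf{v}\in E_+$. *)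

theory Defs
  imports "HOL-Analysis.Analysis"
begin

text \<open>
  The positive cone of an ordered Banach space is \<^term>\<open>{x. 0 \<le> x}\<close>. That it is a proper convex
  cone inducing the order is what \<^class>\<open>ordered_real_vector\<close> provides (properness, that is, containing
  no two opposite nonzero vectors, is antisymmetry of the order); closedness is added here. Only
  these properties are required: the cone need not be generating or normal, and the order need not be
  a lattice order.
\<close>

class ordered_banach = banach + ordered_real_vector +
  assumes closed_nonneg: "closed {x. 0 \<le> x}"

lemma ordered_banach_cone:
  fixes P :: "'a :: ordered_banach set"
  defines "P \<equiv> {x. 0 \<le> x}"
  shows "closed P" "convex P" "cone P" "P \<inter> uminus ` P = {0}"
    and "x \<le> y \<longleftrightarrow> y - x \<in> P"
proof -
  show "closed P" by (simp add: P_def closed_nonneg)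
  show "convex P" by (simp add: P_def convex_def scaleR_nonneg_nonneg add_nonneg_nonneg)
  show "cone P" by (simp add: P_def cone_def scaleR_nonneg_nonneg)
  show "P \<inter> uminus ` P = {0}" by (auto simp: P_def image_iff intro: order.antisym)
  show "x \<le> y \<longleftrightarrow> y - x \<in> P" by (simp add: P_def)
qed

instance real :: ordered_banach
  by standard (simp add: closed_Collect_le)

text \<open>
  Only the values of \<open>\<omega>\<close> on the nonnegative reals matter, so functions from the nonnegative reals are
  represented by functions on all reals.
\<close>

definition omega_convex_on ::
    "'a :: real_normed_vector set \<Rightarrow> (real \<Rightarrow> 'b :: ordered_real_vector) \<Rightarrow> ('a \<Rightarrow> 'b) \<Rightarrow> bool"
  where "omega_convex_on C \<omega> \<Phi> \<longleftrightarrow>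
    (\<forall>u\<in>C. \<forall>v\<in>C. \<forall>l::real. 0 < l \<and> l < 1 \<longrightarrow>
      \<Phi> ((1 - l) *\<^sub>R u + l *\<^sub>R v)
        \<le> (1 - l) *\<^sub>R \<Phi> u + l *\<^sub>R \<Phi> v - (l * (1 - l)) *\<^sub>R \<omega> (norm (u - v)))"

definition has_gateaux_derivative ::
    "('a :: real_normed_vector \<Rightarrow> 'b :: real_normed_vector) \<Rightarrow> ('a \<Rightarrow> 'b) \<Rightarrow> 'a \<Rightarrow> bool"
  where "has_gateaux_derivative \<Phi> D a \<longleftrightarrow>
    bounded_linear D \<and>
    (\<forall>v. ((\<lambda>t::real. (\<Phi> (a + t *\<^sub>R v) - \<Phi> a) /\<^sub>R t) \<longlongrightarrow> D v) (at 0))"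

lemma has_gateaux_derivative_unique:
  assumes "has_gateaux_derivative \<Phi> D a" "has_gateaux_derivative \<Phi> D' a"
  shows "D = D'"
  using assms unfolding has_gateaux_derivative_def
  by (meson LIM_unique ext)

definition isotone_differential_on ::
    "'a :: ordered_real_vector set \<Rightarrow> ('a \<Rightarrow> 'a \<Rightarrow> 'b :: ordered_real_vector) \<Rightarrow> bool"
  where "isotone_differential_on C \<Phi>' \<longleftrightarrow>
    (\<forall>a\<in>C. \<forall>b\<in>C. a \<le> b \<longrightarrow> (\<forall>v\<ge>0. \<Phi>' a v \<le> \<Phi>' b v))"

end

theory Submission
  imports Defs
begin

text \<open>
  Write \<open>m = (x + y + z) / 3\<close> and let \<open>P\<close>, \<open>Q\<close>, \<open>R\<close> be the midpoints of \<open>xy\<close>, \<open>yz\<close>, \<open>zx\<close>.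
  The argument is the transport behind the Hardy--Littlewood--Polya inequality: the masses at
  \<open>x, y, z, m\<close> (\<open>1/3, 1/3, 1/3, 1\<close>) are distributed over \<open>P, Q, R\<close> (\<open>2/3\<close> each) in the order in which
  the points lie, and the tangent inequality
  \<open>\<Phi> v \<ge> \<Phi> u + \<Phi>' u (v - u) + \<kappa> (norm (u - v))\<close>
  is summed over the transport plan, with \<open>u\<close> a midpoint. When \<open>y \<le> m\<close>, the mass \<open>1/3\<close> of
  \<open>x\<close> and \<open>1/3\<close> of \<open>m\<close> go to \<open>P\<close>, the rest of \<open>m\<close> to \<open>R\<close>, and \<open>y\<close>, \<open>z\<close> go to \<open>Q\<close>; the case
  \<open>m \<le> y\<close> is the mirror image. The derivative terms add up to
  \<open>(2/3) (\<Phi>' P - \<Phi>' R) (R - m)\<close>, respectively \<open>(2/3) (\<Phi>' R - \<Phi>' Q) (m - R)\<close>, and are nonnegative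
  because the differential is isotone.

  Letting \<open>\<lambda> \<rightarrow> 0\<close> in the definition of \<open>\<omega>\<close>-convexity gives the tangent inequality with
  \<open>\<kappa> = \<omega>\<close>, and this would produce twice the error terms of the theorem. As \<open>\<omega>\<close> may be
  negative, that is not stronger than what is claimed. But along comparable points the isotone
  differential alone yields the tangent inequality with \<open>\<kappa> = 0\<close>, and averaging the two gives
  \<open>\<kappa> = \<omega> / 2\<close>, which is exactly what the theorem needs; all pairs of the
  transport plan are comparable.
\<close>

section \<open>Integrals and limits in ordered Banach spaces\<close>

lemma nonneg_limit:
  fixes f :: "'a \<Rightarrow> 'b :: ordered_banach"
  assumes "(f \<longlongrightarrow> l) F" "F \<noteq> bot" "eventually (\<lambda>t. 0 \<le> f t) F"
  shows "0 \<le> l"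
  using Lim_in_closed_set[OF closed_nonneg _ assms(2,1)] assms(3) by simp

text \<open>
  Riemann sums of a nonnegative function lie in the positive cone, which is closed.
\<close>

lemma has_integral_nonneg_ordered_banach:
  fixes f :: "real \<Rightarrow> 'b :: ordered_banach"
  assumes int: "(f has_integral I) {a..b}" and nonneg: "\<And>t. t \<in> {a..b} \<Longrightarrow> 0 \<le> f t"
  shows "0 \<le> I"
proof -
  have "\<exists>s\<in>{x::'b. 0 \<le> x}. dist s I < e" if "e > 0" for e
  proof -
    obtain \<gamma> where \<gamma>: "gauge \<gamma>"
      and close: "\<And>D. D tagged_division_of cbox a b \<Longrightarrow> \<gamma> fine D \<Longrightarrow>
                    norm ((\<Sum>(x,k)\<in>D. measure lborel k *\<^sub>R f x) - I) < e"
      using int \<open>e > 0\<close> unfolding box_real(2)[symmetric] has_integral by metis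
    obtain D where D: "D tagged_division_of cbox a b" "\<gamma> fine D"
      using fine_division_exists[OF \<gamma>] by blast
    have "0 \<le> (\<Sum>(x,k)\<in>D. measure lborel k *\<^sub>R f x)"
    proof (rule sum_nonneg, clarify)
      fix x k assume "(x, k) \<in> D"
      then have "x \<in> {a..b}"
        using tag_in_interval[OF D(1)] by simp
      then show "0 \<le> measure lborel k *\<^sub>R f x"
        by (intro scaleR_nonneg_nonneg nonneg) simp_all
    qed
    with close[OF D] show ?thesis
      by (auto simp: dist_norm)
  qed
  then have "I \<in> {x. 0 \<le> x}"
    using closed_approachable[OF closed_nonneg] by blast
  then show ?thesis by simp
qed

section \<open>Tangent inequalities\<close>

lemma gateaux_vector_derivative_along_line:
  assumes "has_gateaux_derivative \<Phi> D (a + t *\<^sub>R v)"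
  shows "((\<lambda>s. \<Phi> (a + s *\<^sub>R v)) has_vector_derivative D v) (at t within S)"
proof -
  have "((\<lambda>h. (\<Phi> (a + (t + h) *\<^sub>R v) - \<Phi> (a + t *\<^sub>R v)) /\<^sub>R h) \<longlongrightarrow> D v) (at 0)"
    using assms unfolding has_gateaux_derivative_def by (simp add: scaleR_left_distrib add.assoc)
  then have quotient: "((\<lambda>s. (\<Phi> (a + s *\<^sub>R v) - \<Phi> (a + t *\<^sub>R v)) /\<^sub>R (s - t)) \<longlongrightarrow> D v) (at t)"
    by (subst LIM_offset_zero_iff) simp_all
  have "((\<lambda>s. \<Phi> (a + s *\<^sub>R v)) has_vector_derivative D v) (at t)"
  proof -
    have "norm ((\<Phi> (a + s *\<^sub>R v) - \<Phi> (a + t *\<^sub>R v)) /\<^sub>R (s - t) - D v)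
        = norm (\<Phi> (a + s *\<^sub>R v) - \<Phi> (a + t *\<^sub>R v) - (s - t) *\<^sub>R D v) / norm (s - t)"
      if "s \<noteq> t" for s
    proof -
      have "(\<Phi> (a + s *\<^sub>R v) - \<Phi> (a + t *\<^sub>R v)) /\<^sub>R (s - t) - D v
          = (\<Phi> (a + s *\<^sub>R v) - \<Phi> (a + t *\<^sub>R v) - (s - t) *\<^sub>R D v) /\<^sub>R (s - t)"
        using that by (simp add: scaleR_right_diff_distrib)
      then show ?thesis by (simp add: divide_inverse_commute)
    qed
    with quotient show ?thesis
      unfolding has_vector_derivative_def has_derivative_iff_norm
      by (auto simp: bounded_linear_scaleR_left eventually_at_filter
          dest!: tendsto_norm_zero[OF LIM_zero] elim!: Lim_transform_eventually)
  qed
  then show ?thesis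
    by (rule has_vector_derivative_at_within)
qed

text \<open>
  The derivative of \<open>\<Phi>\<close> along the segment from \<open>u\<close> to \<open>v\<close> is at least its value at \<open>u\<close>, whichever
  of the two points is the larger one; integrate. Integrability is no issue for the Henstock--Kurzweil
  integral, although the derivative need not be continuous.
\<close>

lemma tangent_inequality_of_isotone_differential:
  fixes \<Phi> :: "'e :: ordered_banach \<Rightarrow> 'f :: ordered_banach"
  assumes "convex C"
    and gateaux: "\<And>a. a \<in> C \<Longrightarrow> has_gateaux_derivative \<Phi> (\<Phi>' a) a"
    and iso: "isotone_differential_on C \<Phi>'"
    and "u \<in> C" "v \<in> C" and comparable: "u \<le> v \<or> v \<le> u"
  shows "\<Phi> u + \<Phi>' u (v - u) \<le> \<Phi> v"
proof -
  define p where "p t = u + t *\<^sub>R (v - u)" for t :: real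
  have pC: "p t \<in> C" if "t \<in> {0..1}" for t
    using convexD_alt[OF \<open>convex C\<close> \<open>u \<in> C\<close> \<open>v \<in> C\<close>, of t] that
    by (simp add: p_def algebra_simps)
  have "((\<lambda>t. \<Phi> (p t)) has_vector_derivative \<Phi>' (p t) (v - u)) (at t within {0..1})"
    if "t \<in> {0..1}" for t
    using gateaux_vector_derivative_along_line[OF gateaux[OF pC[OF that], unfolded p_def]]
    by (simp add: p_def)
  then have "((\<lambda>t. \<Phi>' (p t) (v - u)) has_integral (\<Phi> (p 1) - \<Phi> (p 0))) {0..1}"
    by (intro fundamental_theorem_of_calculus) simp_all
  moreover have "((\<lambda>t. \<Phi>' u (v - u)) has_integral \<Phi>' u (v - u)) {0..1::real}"
    using has_integral_const_real[of "\<Phi>' u (v - u)" 0 1] by simp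
  ultimately have "((\<lambda>t. \<Phi>' (p t) (v - u) - \<Phi>' u (v - u)) has_integral
      (\<Phi> v - \<Phi> u - \<Phi>' u (v - u))) {0..1}"
    by (auto simp: p_def dest: has_integral_diff)
  moreover have "0 \<le> \<Phi>' (p t) (v - u) - \<Phi>' u (v - u)" if t: "t \<in> {0..1}" for t
    using comparable
  proof
    assume "u \<le> v"
    then have "u \<le> p t" using t by (simp add: p_def scaleR_nonneg_nonneg)
    with \<open>u \<le> v\<close> show ?thesis
      using iso pC[OF t] \<open>u \<in> C\<close> unfolding isotone_differential_on_def by simp
  next
    assume "v \<le> u"
    then have "p t \<le> u"
      using t by (simp add: p_def scaleR_nonneg_nonpos)
    with \<open>v \<le> u\<close> have "\<Phi>' (p t) (u - v) \<le> \<Phi>' u (u - v)"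
      using iso pC[OF t] \<open>u \<in> C\<close> unfolding isotone_differential_on_def by simp
    moreover have "\<Phi>' a (v - u) = - \<Phi>' a (u - v)" if "a \<in> C" for a
      using bounded_linear.linear[of "\<Phi>' a"] gateaux[OF that] linear_neg[of "\<Phi>' a" "u - v"]
      unfolding has_gateaux_derivative_def by simp
    ultimately show ?thesis
      using pC[OF t] \<open>u \<in> C\<close> by simp
  qed
  ultimately have "0 \<le> \<Phi> v - \<Phi> u - \<Phi>' u (v - u)"
    by (rule has_integral_nonneg_ordered_banach)
  then show ?thesis by (simp add: algebra_simps)
qed

text \<open>
  Dividing the defining inequality by the weight \<open>t\<close> of \<open>v\<close> bounds the difference quotient of \<open>\<Phi>\<close>
  at \<open>u\<close>; then \<open>t\<close> tends to \<open>0\<close> from the right.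
\<close>

lemma tangent_inequality_of_omega_convex:
  fixes \<Phi> :: "'e :: real_normed_vector \<Rightarrow> 'f :: ordered_banach"
  assumes conv: "omega_convex_on C \<omega> \<Phi>"
    and gateaux: "has_gateaux_derivative \<Phi> D u"
    and "u \<in> C" "v \<in> C"
  shows "\<Phi> u + D (v - u) + \<omega> (norm (u - v)) \<le> \<Phi> v"
proof -
  let ?q = "\<lambda>t::real. (\<Phi> (u + t *\<^sub>R (v - u)) - \<Phi> u) /\<^sub>R t"
  let ?w = "\<omega> (norm (u - v))"
  have "(?q \<longlongrightarrow> D (v - u)) (at_right 0)"
    using gateaux unfolding has_gateaux_derivative_def
    by (blast intro: filterlim_mono[OF _ order_refl at_le[OF subset_UNIV]])
  moreover have "((\<lambda>t. \<Phi> v - \<Phi> u - (1 - t) *\<^sub>R ?w) \<longlongrightarrow> \<Phi> v - \<Phi> u - (1 - 0) *\<^sub>R ?w) (at_right 0)"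
    by (intro tendsto_intros)
  ultimately have lim: "((\<lambda>t. \<Phi> v - \<Phi> u - (1 - t) *\<^sub>R ?w - ?q t) \<longlongrightarrow>
      \<Phi> v - \<Phi> u - (1 - 0) *\<^sub>R ?w - D (v - u)) (at_right 0)"
    by (rule tendsto_diff[rotated])
  have "0 \<le> \<Phi> v - \<Phi> u - (1 - t) *\<^sub>R ?w - ?q t" if t: "0 < t" "t < 1" for t
  proof -
    have "\<Phi> ((1 - t) *\<^sub>R u + t *\<^sub>R v) \<le> (1 - t) *\<^sub>R \<Phi> u + t *\<^sub>R \<Phi> v - (t * (1 - t)) *\<^sub>R ?w"
      using conv t \<open>u \<in> C\<close> \<open>v \<in> C\<close> unfolding omega_convex_on_def by blast
    moreover have "(1 - t) *\<^sub>R u + t *\<^sub>R v = u + t *\<^sub>R (v - u)"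
      by (simp add: algebra_simps)
    ultimately have "\<Phi> (u + t *\<^sub>R (v - u)) - \<Phi> u \<le> t *\<^sub>R (\<Phi> v - \<Phi> u - (1 - t) *\<^sub>R ?w)"
      by (simp add: algebra_simps)
    then have "?q t \<le> (t *\<^sub>R (\<Phi> v - \<Phi> u - (1 - t) *\<^sub>R ?w)) /\<^sub>R t"
      using t by (intro scaleR_left_mono) simp_all
    then show ?thesis using t by simp
  qed
  then have "eventually (\<lambda>t. 0 \<le> \<Phi> v - \<Phi> u - (1 - t) *\<^sub>R ?w - ?q t) (at_right 0)"
    unfolding eventually_at_right_field by (intro exI[of _ 1]) auto
  from nonneg_limit[OF lim _ this] show ?thesis
    by (simp add: algebra_simps)
qed

lemma half_omega_tangent_inequality:
  fixes \<Phi> :: "'e :: ordered_banach \<Rightarrow> 'f :: ordered_banach"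
  assumes "convex C" "omega_convex_on C \<omega> \<Phi>"
    and "\<And>a. a \<in> C \<Longrightarrow> has_gateaux_derivative \<Phi> (\<Phi>' a) a"
    and "isotone_differential_on C \<Phi>'"
    and "u \<in> C" "v \<in> C" "u \<le> v \<or> v \<le> u"
  shows "\<Phi> u + \<Phi>' u (v - u) + (1/2) *\<^sub>R \<omega> (norm (u - v)) \<le> \<Phi> v"
proof -
  have "(1/2) *\<^sub>R (\<Phi> u + \<Phi>' u (v - u) + \<omega> (norm (u - v))) + (1/2) *\<^sub>R (\<Phi> u + \<Phi>' u (v - u))
      \<le> (1/2) *\<^sub>R \<Phi> v + (1/2) *\<^sub>R \<Phi> v"
    using assms
    by (intro add_mono scaleR_left_mono tangent_inequality_of_omega_convex
        tangent_inequality_of_isotone_differential) auto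
  moreover have "(1/2) *\<^sub>R (\<Phi> u + \<Phi>' u (v - u) + \<omega> (norm (u - v))) + (1/2) *\<^sub>R (\<Phi> u + \<Phi>' u (v - u))
      = ((1/2) *\<^sub>R (\<Phi> u + \<Phi>' u (v - u)) + (1/2) *\<^sub>R (\<Phi> u + \<Phi>' u (v - u)))
        + (1/2) *\<^sub>R \<omega> (norm (u - v))"
    by (simp only: scaleR_right_distrib ac_simps)
  ultimately show ?thesis
    by (simp flip: scaleR_left_distrib)
qed

section \<open>Summing the tangent inequalities\<close>

text \<open>
  Linear identities between vectors with coefficients in \<open>(1/6) \<int>\<close> are verified by multiplying
  through by \<open>6\<close> and writing each integer multiple as a repeated sum, so that only cancellation in the
  additive group is left.
\<close>

lemma scaleR_numeral_unfold:
  fixes a :: "'a :: real_vector"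
  shows "numeral (num.Bit0 k) *\<^sub>R a = numeral k *\<^sub>R a + numeral k *\<^sub>R a"
    and "numeral (num.Bit1 k) *\<^sub>R a = numeral k *\<^sub>R a + numeral k *\<^sub>R a + a"
  by (simp_all only: numeral_Bit0 numeral_Bit1 scaleR_left_distrib scaleR_one)

lemma vector_eqI_sixfold:
  fixes a b :: "'a :: real_vector"
  assumes "6 *\<^sub>R a = 6 *\<^sub>R b"
  shows "a = b"
  using assms by simp

text \<open>
  The summation over the transport plan, with the function values, derivative terms and error terms
  as independent vectors; \<open>d_vu\<close> stands for the derivative at \<open>u\<close> in direction \<open>v - u\<close>. Exchanging
  \<open>a\<close> with \<open>c\<close> and \<open>p\<close> with \<open>q\<close> makes it serve both cases of the theorem.
\<close>

lemma sum_of_tangent_inequalities: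
  fixes a b c m p q r :: "'a :: ordered_real_vector"
  assumes "p + d_ap + (1/2) *\<^sub>R w1 \<le> a"
    and "p + d_mp + (1/2) *\<^sub>R w2 \<le> m"
    and "r + d_mr + (1/2) *\<^sub>R w3 \<le> m"
    and "q + d_bq + (1/2) *\<^sub>R w4 \<le> b"
    and "q + d_cq + (1/2) *\<^sub>R w4 \<le> c"
    and "0 \<le> d_ap + d_mp + d_bq + d_cq + 2 *\<^sub>R d_mr"
  shows "(2/3) *\<^sub>R (p + q + r)
      + (1/6) *\<^sub>R w1 + (1/6) *\<^sub>R w2 + (1/3) *\<^sub>R w3 + (1/3) *\<^sub>R w4
    \<le> (a + b + c) /\<^sub>R 3 + m"
proof -
  define d where "d = d_ap + d_mp + d_bq + d_cq + 2 *\<^sub>R d_mr"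
  have "0 \<le> (1/3) *\<^sub>R (a - (p + d_ap + (1/2) *\<^sub>R w1))
      + (1/3) *\<^sub>R (m - (p + d_mp + (1/2) *\<^sub>R w2))
      + (2/3) *\<^sub>R (m - (r + d_mr + (1/2) *\<^sub>R w3))
      + (1/3) *\<^sub>R (b - (q + d_bq + (1/2) *\<^sub>R w4))
      + (1/3) *\<^sub>R (c - (q + d_cq + (1/2) *\<^sub>R w4))
      + (1/3) *\<^sub>R d"
    using assms unfolding d_def[symmetric] by (intro add_nonneg_nonneg scaleR_nonneg_nonneg) simp_all
  also have "\<dots> = (a + b + c) /\<^sub>R 3 + m - ((2/3) *\<^sub>R (p + q + r)
      + (1/6) *\<^sub>R w1 + (1/6) *\<^sub>R w2 + (1/3) *\<^sub>R w3 + (1/3) *\<^sub>R w4)"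
    unfolding d_def
    by (rule vector_eqI_sixfold, simp add: scaleR_right_distrib scaleR_right_diff_distrib)
      (simp add: algebra_simps scaleR_numeral_unfold)
  finally show ?thesis by simp
qed

theorem theorem10:
  fixes C :: "'e :: ordered_banach set"
    and \<Phi> :: "'e \<Rightarrow> 'f :: ordered_banach"
    and \<Phi>' :: "'e \<Rightarrow> 'e \<Rightarrow> 'f"
    and \<omega> :: "real \<Rightarrow> 'f"
    and x y z :: 'e
  assumes "open C" and "convex C"
    and "x \<in> C" and "y \<in> C" and "z \<in> C"
    and "x \<ge> y" and "y \<ge> z"
    and "omega_convex_on C \<omega> \<Phi>"
    and "\<And>a. a \<in> C \<Longrightarrow> has_gateaux_derivative \<Phi> (\<Phi>' a) a"
    and "isotone_differential_on C \<Phi>'"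
  shows "(x \<ge> (x + y + z) /\<^sub>R 3 \<and> (x + y + z) /\<^sub>R 3 \<ge> y \<and> y \<ge> z \<longrightarrow>
      (\<Phi> x + \<Phi> y + \<Phi> z) /\<^sub>R 3 + \<Phi> ((x + y + z) /\<^sub>R 3)
      \<ge> (2/3) *\<^sub>R (\<Phi> ((x + y) /\<^sub>R 2) + \<Phi> ((y + z) /\<^sub>R 2) + \<Phi> ((z + x) /\<^sub>R 2))
        + (1/6) *\<^sub>R \<omega> (norm (x - y) / 2)
        + (1/6) *\<^sub>R \<omega> (norm (2 *\<^sub>R z - x - y) / 6)
        + (1/3) *\<^sub>R \<omega> (norm (2 *\<^sub>R y - x - z) / 6)
        + (1/3) *\<^sub>R \<omega> (norm (z - y) / 2))
    \<and> (x \<ge> y \<and> y \<ge> (x + y + z) /\<^sub>R 3 \<and> (x + y + z) /\<^sub>R 3 \<ge> z \<longrightarrow>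
      (\<Phi> x + \<Phi> y + \<Phi> z) /\<^sub>R 3 + \<Phi> ((x + y + z) /\<^sub>R 3)
      \<ge> (2/3) *\<^sub>R (\<Phi> ((x + y) /\<^sub>R 2) + \<Phi> ((y + z) /\<^sub>R 2) + \<Phi> ((z + x) /\<^sub>R 2))
        + (1/3) *\<^sub>R \<omega> (norm (x - y) / 2)
        + (1/6) *\<^sub>R \<omega> (norm (2 *\<^sub>R x - y - z) / 6)
        + (1/3) *\<^sub>R \<omega> (norm (2 *\<^sub>R y - x - z) / 6)
        + (1/6) *\<^sub>R \<omega> (norm (z - y) / 2))"
proof -
  define m where "m = (x + y + z) /\<^sub>R 3"
  define P where "P = (x + y) /\<^sub>R 2"
  define Q where "Q = (y + z) /\<^sub>R 2"
  define R where "R = (z + x) /\<^sub>R 2"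
  have diffs: "P - x = (-1/2) *\<^sub>R (x - y)" "P - y = (1/2) *\<^sub>R (x - y)"
    "P - m = (-1/6) *\<^sub>R (2 *\<^sub>R z - x - y)"
    "Q - y = (1/2) *\<^sub>R (z - y)" "Q - z = (-1/2) *\<^sub>R (z - y)"
    "Q - m = (-1/6) *\<^sub>R (2 *\<^sub>R x - y - z)"
    "R - m = (-1/6) *\<^sub>R (2 *\<^sub>R y - x - z)"
    and R_m: "R - m = (1/2) *\<^sub>R (m - y)"
    and P_R: "P - R = (1/2) *\<^sub>R (y - z)" and R_Q: "R - Q = (1/2) *\<^sub>R (x - y)"
    and balance_P: "(x - P) + (m - P) = 2 *\<^sub>R (R - m)" "(x - P) + (y - P) = 0"
    and balance_Q: "(z - Q) + (m - Q) = 2 *\<^sub>R (R - m)" "(y - Q) + (z - Q) = 0"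
    unfolding P_def Q_def R_def m_def
    by (rule vector_eqI_sixfold, simp add: scaleR_right_distrib scaleR_right_diff_distrib,
        simp add: algebra_simps scaleR_numeral_unfold)+
  have norms: "norm (P - x) = norm (x - y) / 2" "norm (P - y) = norm (x - y) / 2"
    "norm (P - m) = norm (2 *\<^sub>R z - x - y) / 6"
    "norm (Q - y) = norm (z - y) / 2" "norm (Q - z) = norm (z - y) / 2"
    "norm (Q - m) = norm (2 *\<^sub>R x - y - z) / 6"
    "norm (R - m) = norm (2 *\<^sub>R y - x - z) / 6"
    unfolding diffs norm_scaleR by simp_all
  have "0 \<le> (1/2) *\<^sub>R (x - y)" "0 \<le> (1/2) *\<^sub>R (y - z)"
    using \<open>y \<le> x\<close> \<open>z \<le> y\<close> by (simp_all add: scaleR_nonneg_nonneg)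
  moreover have "x - P = (1/2) *\<^sub>R (x - y)" "y - Q = (1/2) *\<^sub>R (y - z)" "Q - z = (1/2) *\<^sub>R (y - z)"
    using diffs(1,4,5) by (simp_all add: algebra_simps)
  ultimately have order: "P \<le> x" "y \<le> P" "Q \<le> y" "z \<le> Q" "R \<le> P" "Q \<le> R"
    using diffs(2) P_R R_Q by (metis diff_ge_0_iff_ge)+

  have midpoint_in: "(a + b) /\<^sub>R 2 \<in> C" if "a \<in> C" "b \<in> C" for a b
    using convexD[OF \<open>convex C\<close> that, of "1/2" "1/2"]
    by (simp add: scaleR_right_distrib inverse_eq_divide)
  have inC: "P \<in> C" "Q \<in> C" "R \<in> C"
    unfolding P_def Q_def R_def by (intro midpoint_in assms(3-5))+
  have "m = (1/3) *\<^sub>R x + (2/3) *\<^sub>R Q"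
    by (simp add: m_def Q_def scaleR_right_distrib inverse_eq_divide)
  then have "m \<in> C"
    using convexD[OF \<open>convex C\<close> \<open>x \<in> C\<close> \<open>Q \<in> C\<close>, of "1/3" "2/3"] by simp

  have linear: "linear (\<Phi>' a)" if "a \<in> C" for a
    using assms(9)[OF that] bounded_linear.linear unfolding has_gateaux_derivative_def by blast
  note isotone = assms(10)[unfolded isotone_differential_on_def, rule_format]
  have tangent: "\<Phi> u + \<Phi>' u (v - u) + (1/2) *\<^sub>R \<omega> r \<le> \<Phi> v"
    if "norm (u - v) = r" "u \<in> C" "v \<in> C" "u \<le> v \<or> v \<le> u" for u v r
    using half_omega_tangent_inequality[of C \<omega> \<Phi> \<Phi>' u v] assms that by blast

  \<comment> \<open>\<open>R - m = (m - y) / 2\<close> settles on which side of \<open>m\<close> the midpoint \<open>R\<close> lies. Below,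
    the derivative terms cancel at one outer midpoint and leave \<open>2 (R - m)\<close> at the other one.\<close>
  have case_a: "(2/3) *\<^sub>R (\<Phi> P + \<Phi> Q + \<Phi> R)
      + (1/6) *\<^sub>R \<omega> (norm (x - y) / 2)
      + (1/6) *\<^sub>R \<omega> (norm (2 *\<^sub>R z - x - y) / 6)
      + (1/3) *\<^sub>R \<omega> (norm (2 *\<^sub>R y - x - z) / 6)
      + (1/3) *\<^sub>R \<omega> (norm (z - y) / 2)
      \<le> (\<Phi> x + \<Phi> y + \<Phi> z) /\<^sub>R 3 + \<Phi> m" if "y \<le> m"
  proof (rule sum_of_tangent_inequalities)
    have "0 \<le> R - m"
      unfolding R_m using that by (simp add: scaleR_nonneg_nonneg)
    then have "m \<le> R" by simp
    show "\<Phi> P + \<Phi>' P (x - P) + (1/2) *\<^sub>R \<omega> (norm (x - y) / 2) \<le> \<Phi> x"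
      "\<Phi> P + \<Phi>' P (m - P) + (1/2) *\<^sub>R \<omega> (norm (2 *\<^sub>R z - x - y) / 6) \<le> \<Phi> m"
      "\<Phi> R + \<Phi>' R (m - R) + (1/2) *\<^sub>R \<omega> (norm (2 *\<^sub>R y - x - z) / 6) \<le> \<Phi> m"
      "\<Phi> Q + \<Phi>' Q (y - Q) + (1/2) *\<^sub>R \<omega> (norm (z - y) / 2) \<le> \<Phi> y"
      "\<Phi> Q + \<Phi>' Q (z - Q) + (1/2) *\<^sub>R \<omega> (norm (z - y) / 2) \<le> \<Phi> z"
      using order \<open>m \<le> R\<close> \<open>m \<in> C\<close> inC assms(3-5) norms
      by (auto intro!: tangent intro: order_trans)
    have "\<Phi>' P (x - P) + \<Phi>' P (m - P) = 2 *\<^sub>R \<Phi>' P (R - m)"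
      using linear[OF \<open>P \<in> C\<close>] balance_P(1) by (metis linear_add linear_scale)
    moreover have "\<Phi>' Q (y - Q) + \<Phi>' Q (z - Q) = 0"
      using linear[OF \<open>Q \<in> C\<close>] balance_Q(2) by (metis linear_add linear_0)
    moreover have "\<Phi>' R (m - R) = - \<Phi>' R (R - m)"
      using linear[OF \<open>R \<in> C\<close>] by (metis linear_neg minus_diff_eq)
    ultimately have "\<Phi>' P (x - P) + \<Phi>' P (m - P) + \<Phi>' Q (y - Q) + \<Phi>' Q (z - Q) + 2 *\<^sub>R \<Phi>' R (m - R)
        = 2 *\<^sub>R (\<Phi>' P (R - m) - \<Phi>' R (R - m))"
      by (simp add: algebra_simps)
    also have "0 \<le> \<dots>"
      using isotone[OF \<open>R \<in> C\<close> \<open>P \<in> C\<close> \<open>R \<le> P\<close> \<open>0 \<le> R - m\<close>] by (simp add: scaleR_nonneg_nonneg)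
    finally show "0 \<le> \<Phi>' P (x - P) + \<Phi>' P (m - P) + \<Phi>' Q (y - Q) + \<Phi>' Q (z - Q)
        + 2 *\<^sub>R \<Phi>' R (m - R)" .
  qed

  have case_b: "(2/3) *\<^sub>R (\<Phi> Q + \<Phi> P + \<Phi> R)
      + (1/6) *\<^sub>R \<omega> (norm (z - y) / 2)
      + (1/6) *\<^sub>R \<omega> (norm (2 *\<^sub>R x - y - z) / 6)
      + (1/3) *\<^sub>R \<omega> (norm (2 *\<^sub>R y - x - z) / 6)
      + (1/3) *\<^sub>R \<omega> (norm (x - y) / 2)
      \<le> (\<Phi> z + \<Phi> y + \<Phi> x) /\<^sub>R 3 + \<Phi> m" if "m \<le> y"
  proof (rule sum_of_tangent_inequalities)
    have "m - R = (1/2) *\<^sub>R (y - m)"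
      using R_m by (simp add: algebra_simps)
    then have "0 \<le> m - R"
      using that by (simp add: scaleR_nonneg_nonneg)
    then have "R \<le> m" by simp
    show "\<Phi> Q + \<Phi>' Q (z - Q) + (1/2) *\<^sub>R \<omega> (norm (z - y) / 2) \<le> \<Phi> z"
      "\<Phi> Q + \<Phi>' Q (m - Q) + (1/2) *\<^sub>R \<omega> (norm (2 *\<^sub>R x - y - z) / 6) \<le> \<Phi> m"
      "\<Phi> R + \<Phi>' R (m - R) + (1/2) *\<^sub>R \<omega> (norm (2 *\<^sub>R y - x - z) / 6) \<le> \<Phi> m"
      "\<Phi> P + \<Phi>' P (y - P) + (1/2) *\<^sub>R \<omega> (norm (x - y) / 2) \<le> \<Phi> y"
      "\<Phi> P + \<Phi>' P (x - P) + (1/2) *\<^sub>R \<omega> (norm (x - y) / 2) \<le> \<Phi> x"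
      using order \<open>R \<le> m\<close> \<open>m \<in> C\<close> inC assms(3-5) norms
      by (auto intro!: tangent intro: order_trans)
    have "\<Phi>' Q (z - Q) + \<Phi>' Q (m - Q) = - (2 *\<^sub>R \<Phi>' Q (m - R))"
      using linear[OF \<open>Q \<in> C\<close>] balance_Q(1)
      by (metis linear_add linear_scale linear_neg minus_diff_eq scaleR_minus_right)
    moreover have "\<Phi>' P (y - P) + \<Phi>' P (x - P) = 0"
      using linear[OF \<open>P \<in> C\<close>] balance_P(2) by (metis linear_add linear_0 add.commute)
    ultimately have "\<Phi>' Q (z - Q) + \<Phi>' Q (m - Q) + \<Phi>' P (y - P) + \<Phi>' P (x - P) + 2 *\<^sub>R \<Phi>' R (m - R)
        = 2 *\<^sub>R (\<Phi>' R (m - R) - \<Phi>' Q (m - R))"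
      by (simp add: algebra_simps)
    also have "0 \<le> \<dots>"
      using isotone[OF \<open>Q \<in> C\<close> \<open>R \<in> C\<close> \<open>Q \<le> R\<close> \<open>0 \<le> m - R\<close>] by (simp add: scaleR_nonneg_nonneg)
    finally show "0 \<le> \<Phi>' Q (z - Q) + \<Phi>' Q (m - Q) + \<Phi>' P (y - P) + \<Phi>' P (x - P)
        + 2 *\<^sub>R \<Phi>' R (m - R)" .
  qed

  from case_a case_b show ?thesis
    unfolding P_def Q_def R_def m_def by (simp only: ac_simps) blast
qed

end
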